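(* For any $0\leq m<n\leq\infty$ ($m$ an integer, $n$ an integer or $\infty$): (1) $d_{\mathrm{GH}}(\mathbb{S}^m_{\mathrm{E}},\mathbb{S}^n_{\mathrm{E}})\leq\sin\big(d_{\mathrm{GH}}(\mathbb{S}^m,\mathbb{S}^n)\big)$. (2) More generally, for any nonempty $X\subseteq\mathbb{S}^m$ and nonempty $Y\subseteq\mathbb{S}^n$, $d_{\mathrm{GH}}(X_{\mathrm{E}},Y_{\mathrm{E}})\leq\sin\big(d_{\mathrm{GH}}(X,Y)\big)$.
   Context: For an integer $m\ge 0$, $\mathbb{S}^m=\{x\in\mathbb{R}^{m+1}:\|x\|=1\}$ is the unit sphere with the geodesic distance $\arccos\langle x,x'\rangle$; $\mathbb{S}^\infty$ is the unit sphere of the real Hilbert space $\ell^2$ with distance $\arccos\langle x,x'\rangle$. Subsets $X\subseteq\mathbb{S}^m$ carry the restricted geodesic distance, while $X_{\mathrm{E}}$ denotes the same set with the Euclidean (norm) metric $d_{\mathrm{E}}(x,x')=\|x-x'\|$ inherited from the ambient space; in particular $\mathbb{S}^m_{\mathrm{E}}$ is the sphere with the Euclidean metric. The Gromov-Hausdorff distance between bounded metric spaces $X,Y$ is $d_{\mathrm{GH}}(X,Y)=\inf d_{\mathrm{H}}(f(X),g(Y))$, the infimum being over all metric spaces $Z$ and all isometric (distance-preserving) embeddings $f:X\to Z$, $g:Y\to Z$, with $d_{\mathrm{H}}$ the Hausdorff distance in $Z$. Equivalently $d_{\mathrm{GH}}(X,Y)=\frac12\inf_R \operatorname{dis}(R)$,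 where $R\subseteq X\times Y$ ranges over correspondences (relations whose projections to $X$ and to $Y$ are both surjective) and $\operatorname{dis}(R)=\sup_{(x,y),(x',y')\in R}|d_X(x,x')-d_Y(y,y')|$. *)

theory Defs
  imports "HOL-Analysis.Analysis" "HOL-Library.Extended_Nat"
begin

text \<open>
  All spheres live in the real Hilbert space of square-summable sequences.  The space R^(m+1) is
  the subspace of sequences supported on the coordinates 0, ..., m; on it the series below are
  finite sums, namely the usual inner product and norm.
\<close>

definition l2_space :: "(nat \<Rightarrow> real) set" where
  "l2_space = {x. summable (\<lambda>i. (x i)\<^sup>2)}"

definition l2_inner :: "(nat \<Rightarrow> real) \<Rightarrow> (nat \<Rightarrow> real) \<Rightarrow> real" where
  "l2_inner x y = (\<Sum>i. x i * y i)"

definition l2_norm :: "(nat \<Rightarrow> real) \<Rightarrow> real" where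
  "l2_norm x = sqrt (l2_inner x x)"

definition unit_sphere :: "enat \<Rightarrow> (nat \<Rightarrow> real) set" where
  "unit_sphere n = {x \<in> l2_space. (\<forall>i. n < enat i \<longrightarrow> x i = 0) \<and> l2_norm x = 1}"

definition geodesic_dist :: "(nat \<Rightarrow> real) \<Rightarrow> (nat \<Rightarrow> real) \<Rightarrow> real" where
  "geodesic_dist x y = arccos (l2_inner x y)"

definition euclidean_dist :: "(nat \<Rightarrow> real) \<Rightarrow> (nat \<Rightarrow> real) \<Rightarrow> real" where
  "euclidean_dist x y = l2_norm (\<lambda>i. x i - y i)"

lemma unit_sphere_finite_dim:
  "unit_sphere (enat m) = {x. (\<forall>i>m. x i = 0) \<and> (\<Sum>i\<le>m. (x i)\<^sup>2) = 1}"
proof -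
  have *: "(\<lambda>i. (x i)\<^sup>2) sums (\<Sum>i\<le>m. (x i)\<^sup>2)" if "\<forall>i>m. x i = 0" for x :: "nat \<Rightarrow> real"
    by (rule sums_finite) (use that in auto)
  show ?thesis
    using * by (auto simp: unit_sphere_def l2_space_def l2_norm_def l2_inner_def
        sums_iff simp flip: power2_eq_square)
qed

text \<open>
  The real suprema and infima below are meaningful for nonempty bounded sets, the only case in
  which these distances are used.
\<close>

definition hausdorff_dist :: "('a \<Rightarrow> 'a \<Rightarrow> real) \<Rightarrow> 'a set \<Rightarrow> 'a set \<Rightarrow> real" where
  "hausdorff_dist d A B = max (SUP a\<in>A. INF b\<in>B. d a b) (SUP b\<in>B. INF a\<in>A. d a b)"

definition isometric_embedding ::
  "'a set \<Rightarrow> ('a \<Rightarrow> 'a \<Rightarrow> real) \<Rightarrow> 'b set \<Rightarrow> ('b \<Rightarrow> 'b \<Rightarrow> real) \<Rightarrow> ('a \<Rightarrow> 'b) \<Rightarrow> bool" where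
  "isometric_embedding X dX Z dZ f \<longleftrightarrow>
     f \<in> X \<rightarrow> Z \<and> (\<forall>x\<in>X. \<forall>x'\<in>X. dZ (f x) (f x') = dX x x')"

text \<open>
  A definition cannot quantify over all types, so the ambient metric spaces are taken with points
  in the disjoint sum of the two underlying types.  This loses nothing, because an ambient
  space may be cut down to the union of the two images; \<open>gh_dist_le\<close> below gives
  the bound for ambient metric spaces over an arbitrary type.
\<close>

definition gh_dist ::
  "'a set \<Rightarrow> ('a \<Rightarrow> 'a \<Rightarrow> real) \<Rightarrow> 'b set \<Rightarrow> ('b \<Rightarrow> 'b \<Rightarrow> real) \<Rightarrow> real" where
  "gh_dist X dX Y dY =
     Inf {hausdorff_dist dZ (f ` X) (g ` Y) | (Z :: ('a + 'b) set) dZ f g.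
            Metric_space Z dZ \<and> isometric_embedding X dX Z dZ f \<and> isometric_embedding Y dY Z dZ g}"

lemma hausdorff_dist_nonneg:
  fixes Z :: "'c set"
  assumes M: "Metric_space Z d" and A: "A \<subseteq> Z" "A \<noteq> {}" and B: "B \<subseteq> Z" "B \<noteq> {}"
    and bdd: "\<And>x y. x \<in> A \<Longrightarrow> y \<in> A \<Longrightarrow> d x y \<le> C"
  shows "0 \<le> hausdorff_dist d A B"
proof -
  interpret Metric_space Z d by (fact M)
  obtain a b where ab: "a \<in> A" "b \<in> B" using A B by blast
  have bb: "bdd_below ((\<lambda>b. d x b) ` B)" for x
    by (rule bdd_belowI[of _ 0]) auto
  have "(INF b\<in>B. d x b) \<le> C + d a b" if "x \<in> A" for x
  proof -
    have "(INF b\<in>B. d x b) \<le> d x b"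
      using bb ab by (intro cINF_lower)
    also have "\<dots> \<le> d x a + d a b"
      using that ab A B by (intro triangle) auto
    also have "\<dots> \<le> C + d a b"
      using bdd that ab by simp
    finally show ?thesis .
  qed
  hence "bdd_above ((\<lambda>x. INF b\<in>B. d x b) ` A)"
    by (intro bdd_aboveI[of _ "C + d a b"]) auto
  hence "(INF b\<in>B. d a b) \<le> (SUP a\<in>A. INF b\<in>B. d a b)"
    using ab by (intro cSUP_upper)
  moreover have "0 \<le> (INF b\<in>B. d a b)"
    using B by (intro cINF_greatest) auto
  ultimately show ?thesis
    unfolding hausdorff_dist_def by linarith
qed

theorem gh_dist_le:
  fixes X :: "'a set" and Y :: "'b set" and Z :: "'c set"
  assumes M: "Metric_space Z d"
    and f: "isometric_embedding X dX Z d f" and g: "isometric_embedding Y dY Z d g"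
    and ne: "X \<noteq> {}" "Y \<noteq> {}"
    and bdd: "\<And>x x'. x \<in> X \<Longrightarrow> x' \<in> X \<Longrightarrow> dX x x' \<le> C"
  shows "gh_dist X dX Y dY \<le> hausdorff_dist d (f ` X) (g ` Y)"
proof -
  interpret Metric_space Z d by (fact M)
  define h :: "'a + 'b \<Rightarrow> 'c" where "h = case_sum f g"
  define f' :: "'a \<Rightarrow> 'a + 'b" where "f' = (\<lambda>x. Inl (inv_into X f (f x)))"
  define g' :: "'b \<Rightarrow> 'a + 'b" where
    "g' = (\<lambda>y. if g y \<in> f ` X then Inl (inv_into X f (g y)) else Inr (inv_into Y g (g y)))"
  define Z' where "Z' = f' ` X \<union> g' ` Y"
  define d' where "d' = (\<lambda>u v. d (h u) (h v))"
  have hf: "h (f' x) = f x" if "x \<in> X" for x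
    using that by (simp add: h_def f'_def f_inv_into_f)
  have hg: "h (g' y) = g y" if "y \<in> Y" for y
    using that by (auto simp: h_def g'_def f_inv_into_f)
  have fZ: "f x \<in> Z" if "x \<in> X" for x
    using f that by (auto simp: isometric_embedding_def)
  have gZ: "g y \<in> Z" if "y \<in> Y" for y
    using g that by (auto simp: isometric_embedding_def)
  have hZ: "h u \<in> Z" if "u \<in> Z'" for u
    using that hf hg fZ gZ by (auto simp: Z'_def)
  have inj: "u = v" if "u \<in> Z'" "v \<in> Z'" "h u = h v" for u v
  proof -
    have canon: "w = (if h w \<in> f ` X then Inl (inv_into X f (h w)) else Inr (inv_into Y g (h w)))"
      if "w \<in> Z'" for w
      using that unfolding Z'_def
    proof
      assume "w \<in> f' ` X"
      then obtain x where x: "x \<in> X" "w = f' x" by blast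
      then have "h w = f x" using hf by simp
      with x show ?thesis by (simp add: f'_def)
    next
      assume "w \<in> g' ` Y"
      then obtain y where y: "y \<in> Y" "w = g' y" by blast
      then have "h w = g y" using hg by simp
      show ?thesis unfolding \<open>h w = g y\<close> using y(2) unfolding g'_def .
    qed
    show ?thesis
      using canon[OF that(1)] canon[OF that(2)] that(3) by metis
  qed
  have M': "Metric_space Z' d'"
  proof
    show "0 \<le> d' x y" for x y by (simp add: d'_def)
    show "d' x y = d' y x" for x y by (simp add: d'_def commute)
    show "d' x y = 0 \<longleftrightarrow> x = y" if "x \<in> Z'" "y \<in> Z'" for x y
      using hZ[OF that(1)] hZ[OF that(2)] inj[OF that] by (auto simp: d'_def)
    show "d' x z \<le> d' x y + d' y z" if "x \<in> Z'" "y \<in> Z'" "z \<in> Z'" for x y z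
      unfolding d'_def by (intro triangle hZ that)
  qed
  have f': "isometric_embedding X dX Z' d' f'"
    using f hf by (auto simp: isometric_embedding_def d'_def Z'_def)
  have g': "isometric_embedding Y dY Z' d' g'"
    using g hg by (auto simp: isometric_embedding_def d'_def Z'_def)
  have eq: "hausdorff_dist d' (f' ` X) (g' ` Y) = hausdorff_dist d (f ` X) (g ` Y)"
    unfolding hausdorff_dist_def d'_def image_image using hf hg by (simp cong: image_cong_simp)
  let ?S = "{hausdorff_dist dZ (f ` X) (g ` Y) | (Z :: ('a + 'b) set) dZ f g.
            Metric_space Z dZ \<and> isometric_embedding X dX Z dZ f \<and> isometric_embedding Y dY Z dZ g}"
  have "bdd_below ?S"
  proof (rule bdd_belowI[of _ 0], clarify)
    fix Z :: "('a + 'b) set" and dZ f g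
    assume *: "Metric_space Z dZ" "isometric_embedding X dX Z dZ f" "isometric_embedding Y dY Z dZ g"
    show "0 \<le> hausdorff_dist dZ (f ` X) (g ` Y)"
      by (rule hausdorff_dist_nonneg[OF *(1), where C = C])
        (use * ne bdd in \<open>auto simp: isometric_embedding_def\<close>)
  qed
  moreover have "hausdorff_dist d' (f' ` X) (g' ` Y) \<in> ?S"
    using M' f' g' by blast
  ultimately show ?thesis
    unfolding gh_dist_def eq[symmetric] by (rule cInf_lower[rotated])
qed

end

theory Submission
  imports Defs
begin

text \<open>
  On a unit sphere the chord between two points at geodesic distance \<open>t\<close> has length
  \<open>2 sin (t / 2)\<close>.  This function of \<open>t\<close> is increasing and concave on \<open>[0, \<pi>]\<close> and vanishes at
  \<open>0\<close>; hence it satisfies \<open>\<bar>2 sin (a / 2) - 2 sin (b / 2)\<bar> \<le> 2 sin (\<bar>a - b\<bar> / 2)\<close>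
  (\<open>chord_diff_le\<close>).  So a correspondence that distorts geodesic distances by at most
  \<open>2 r \<le> \<pi>\<close> distorts chord lengths by at most \<open>2 sin r\<close>.  As the Gromov-Hausdorff distance is half the
  infimum of the distortions of correspondences, the bound \<open>r\<close> for the geodesic metrics becomes \<open>sin r\<close> for the
  Euclidean ones.

  This is an argument about metric spaces of diameter at most \<open>\<pi>\<close> (\<open>gh_dist_chord_le_sin\<close>).  It rests on
  the two directions of the description by correspondences: a correspondence of small distortion lets
  one glue the two spaces together (\<open>correspondence_imp_glued_metric\<close>), and an ambient space in which the two images are close yields
  a correspondence (\<open>hausdorff_less_imp_correspondence\<close>).

  That the geodesic distance satisfies the triangle inequality has a content of its own: an infimum
  over ambient metric spaces says nothing if there are no such spaces.  The inequality comes from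
  the positivity of the Gram form of three unit vectors (\<open>gram_form_nonneg\<close>).
\<close>

section \<open>The chord function\<close>

definition chord :: "real \<Rightarrow> real" where
  "chord t = 2 * sin (t / 2)"

lemma chord_nonneg: "0 \<le> t \<Longrightarrow> t \<le> pi \<Longrightarrow> 0 \<le> chord t"
  unfolding chord_def by (simp add: sin_ge_zero)

lemma chord_mono: "0 \<le> s \<Longrightarrow> s \<le> t \<Longrightarrow> t \<le> pi \<Longrightarrow> chord s \<le> chord t"
  unfolding chord_def by (simp add: sin_monotone_2pi_le)

lemma chord_eq_0_iff: "0 \<le> t \<Longrightarrow> t \<le> pi \<Longrightarrow> chord t = 0 \<longleftrightarrow> t = 0"
  unfolding chord_def using sin_gt_zero[of "t / 2"] by (cases "t = 0") auto

text \<open>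
  The difference is \<open>4 sin ((a - b) / 4) cos ((a + b) / 4)\<close>.  Replacing \<open>a + b\<close> by the smaller number
  \<open>\<bar>a - b\<bar>\<close> in the cosine is what produces the sine of the double angle; the estimate of the cosine by
  \<open>1\<close> would lose the sharp bound.
\<close>

lemma chord_diff_le:
  assumes "0 \<le> a" "a \<le> pi" "0 \<le> b" "b \<le> pi"
  shows "\<bar>chord a - chord b\<bar> \<le> chord \<bar>a - b\<bar>"
proof -
  have *: "chord a - chord b \<le> chord (a - b) \<and> 0 \<le> chord a - chord b"
    if "b \<le> a" "0 \<le> b" "a \<le> pi" for a b
  proof -
    have "chord a - chord b = 4 * (sin ((a - b) / 4) * cos ((a + b) / 4))"
      unfolding chord_def right_diff_distrib[symmetric] sin_diff_sin
      by (simp add: diff_divide_distrib add_divide_distrib)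
    also have "\<dots> \<le> 4 * (sin ((a - b) / 4) * cos ((a - b) / 4))"
      using that by (intro mult_left_mono cos_monotone_0_pi_le sin_ge_zero) auto
    also have "\<dots> = chord (a - b)"
    proof -
      have "2 * ((a - b) / 4) = (a - b) / 2" by (simp add: field_simps)
      from sin_double[of "(a - b) / 4", unfolded this] show ?thesis
        by (simp add: chord_def)
    qed
    finally show ?thesis
      using chord_mono[of b a] that by simp
  qed
  show ?thesis
    using *[of a b] *[of b a] assms by (cases "b \<le> a") (auto simp: abs_real_def)
qed

lemma Metric_space_chord:
  assumes "Metric_space X d" and le_pi: "\<And>x y. d x y \<le> pi"
  shows "Metric_space X (\<lambda>x y. chord (d x y))"
proof -
  interpret Metric_space X d by fact
  show ?thesis
  proof
    fix x y z assume xyz: "x \<in> X" "y \<in> X" "z \<in> X"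
    have "\<bar>chord (d x z) - chord (d x y)\<bar> \<le> chord \<bar>d x z - d x y\<bar>"
      by (intro chord_diff_le le_pi) auto
    also have "\<dots> \<le> chord (d y z)"
    proof (rule chord_mono)
      show "\<bar>d x z - d x y\<bar> \<le> d y z"
        using triangle[of x y z] triangle[of x z y] commute[of y z] xyz by auto
    qed (auto simp: le_pi)
    finally show "chord (d x z) \<le> chord (d x y) + chord (d y z)"
      by simp
  qed (auto simp: chord_nonneg le_pi commute chord_eq_0_iff)
qed

section \<open>Gromov-Hausdorff distance and correspondences\<close>

definition correspondence :: "'a set \<Rightarrow> 'b set \<Rightarrow> ('a \<times> 'b) set \<Rightarrow> bool" where
  "correspondence X Y R \<longleftrightarrow> R \<subseteq> X \<times> Y \<and> fst ` R = X \<and> snd ` R = Y"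

lemma gh_dist_cong:
  fixes X :: "'a set" and Y :: "'b set"
  assumes "\<And>x x'. x \<in> X \<Longrightarrow> x' \<in> X \<Longrightarrow> dX x x' = dX' x x'"
    and "\<And>y y'. y \<in> Y \<Longrightarrow> y' \<in> Y \<Longrightarrow> dY y y' = dY' y y'"
  shows "gh_dist X dX Y dY = gh_dist X dX' Y dY'"
proof -
  have "isometric_embedding X dX Z = isometric_embedding X dX' Z"
    and "isometric_embedding Y dY Z = isometric_embedding Y dY' Z" for Z :: "('a + 'b) set"
    using assms by (auto simp: isometric_embedding_def fun_eq_iff)
  then show ?thesis
    unfolding gh_dist_def by simp
qed

text \<open>
  Points \<open>x\<close> and \<open>y\<close> of the two spaces are joined through a pair \<open>(p, q) \<in> R\<close>, the step from \<open>p\<close> to \<open>q\<close>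
  having length \<open>c\<close>.  A detour through the other space crosses twice, which costs \<open>2 * c\<close>; the bound on
  the distortion says that this is enough for it not to be a shortcut.  The step must be positive, so
  that \<open>p\<close> and \<open>q\<close> stay distinct.
\<close>

lemma correspondence_imp_glued_metric:
  fixes X :: "'a set" and Y :: "'b set"
  assumes MX: "Metric_space X dX" and MY: "Metric_space Y dY"
    and R: "correspondence X Y R" and ne: "X \<noteq> {}" "Y \<noteq> {}" and c: "0 < c"
    and dis: "\<And>x y x' y'. (x, y) \<in> R \<Longrightarrow> (x', y') \<in> R \<Longrightarrow> \<bar>dX x x' - dY y y'\<bar> \<le> 2 * c"
  obtains Z :: "('a + 'b) set" and dZ where "Metric_space Z dZ"
    "isometric_embedding X dX Z dZ Inl" "isometric_embedding Y dY Z dZ Inr"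
    "hausdorff_dist dZ (Inl ` X) (Inr ` Y) \<le> c"
proof -
  interpret X: Metric_space X dX by fact
  interpret Y: Metric_space Y dY by fact
  have R_sub: "p \<in> X" "q \<in> Y" if "(p, q) \<in> R" for p q
    using R that by (auto simp: correspondence_def)
  have R_ne: "R \<noteq> {}"
    using R ne by (auto simp: correspondence_def)
  define D where "D x y = (INF (p, q)\<in>R. dX x p + dY q y + c)" for x y
  have D_le: "D x y \<le> dX x p + dY q y + c" if "(p, q) \<in> R" for x y p q
    unfolding D_def by (rule cINF_lower2[OF _ that]) (auto intro!: bdd_belowI[of _ 0] simp: c less_imp_le)
  have D_ge: "t \<le> D x y" if "\<And>p q. (p, q) \<in> R \<Longrightarrow> t \<le> dX x p + dY q y + c" for t x y
    unfolding D_def using that by (intro cINF_greatest R_ne) auto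
  have D_pos: "0 < D x y" for x y
    using D_ge[of c x y] c by simp
  define dZ :: "'a + 'b \<Rightarrow> 'a + 'b \<Rightarrow> real" where
    "dZ u v = (case u of Inl x \<Rightarrow> (case v of Inl x' \<Rightarrow> dX x x' | Inr y \<Rightarrow> D x y)
                       | Inr y \<Rightarrow> (case v of Inl x \<Rightarrow> D x y | Inr y' \<Rightarrow> dY y y'))" for u v
  define Z where "Z = X <+> Y"
  have XXY: "D x y \<le> dX x x' + D x' y" if "x \<in> X" "x' \<in> X" for x x' y
  proof -
    have "D x y - dX x x' \<le> D x' y"
    proof (rule D_ge)
      fix p q assume pq: "(p, q) \<in> R"
      show "D x y - dX x x' \<le> dX x' p + dY q y + c"
        using D_le[OF pq, of x y] X.triangle[of x x' p] R_sub[OF pq] that by linarith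
    qed
    then show ?thesis by simp
  qed
  have XYY: "D x y \<le> D x y' + dY y' y" if "y \<in> Y" "y' \<in> Y" for x y y'
  proof -
    have "D x y - dY y' y \<le> D x y'"
    proof (rule D_ge)
      fix p q assume pq: "(p, q) \<in> R"
      show "D x y - dY y' y \<le> dX x p + dY q y' + c"
        using D_le[OF pq, of x y] Y.triangle[of q y' y] R_sub[OF pq] that by linarith
    qed
    then show ?thesis by simp
  qed
  have XXY': "D x' y \<le> D x y + dX x x'" if "x \<in> X" "x' \<in> X" for x x' y
    using XXY[OF that(2,1), of y] X.commute[of x x'] by linarith
  have XYY': "D x y \<le> dY y y' + D x y'" if "y \<in> Y" "y' \<in> Y" for x y y'
    using XYY[OF that, of x] Y.commute[of y y'] by linarith
  have XYX: "dX x x' \<le> D x y + D x' y" if "x \<in> X" "x' \<in> X" "y \<in> Y" for x x' y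
  proof -
    have "dX x x' - D x' y \<le> D x y"
    proof (rule D_ge)
      fix p q assume pq: "(p, q) \<in> R"
      have "dX x x' - (dX x p + dY q y + c) \<le> D x' y"
      proof (rule D_ge)
        fix p' q' assume pq': "(p', q') \<in> R"
        have "dX x x' \<le> dX x p + dX p p' + dX p' x'"
          using X.triangle[of x p x'] X.triangle[of p p' x'] R_sub[OF pq] R_sub[OF pq'] that by linarith
        moreover have "dY q q' \<le> dY q y + dY q' y"
          using Y.triangle[of q y q'] R_sub[OF pq] R_sub[OF pq'] that Y.commute[of y q'] by simp
        ultimately show "dX x x' - (dX x p + dY q y + c) \<le> dX x' p' + dY q' y + c"
          using dis[OF pq pq'] X.commute[of x' p'] by linarith
      qed
      then show "dX x x' - D x' y \<le> dX x p + dY q y + c" by simp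
    qed
    then show ?thesis by simp
  qed
  have YXY: "dY y y' \<le> D x y + D x y'" if "y \<in> Y" "y' \<in> Y" "x \<in> X" for x y y'
  proof -
    have "dY y y' - D x y' \<le> D x y"
    proof (rule D_ge)
      fix p q assume pq: "(p, q) \<in> R"
      have "dY y y' - (dX x p + dY q y + c) \<le> D x y'"
      proof (rule D_ge)
        fix p' q' assume pq': "(p', q') \<in> R"
        have "dY y y' \<le> dY q y + dY q q' + dY q' y'"
          using Y.triangle[of y q y'] Y.triangle[of q q' y'] R_sub[OF pq] R_sub[OF pq'] that
            Y.commute[of y q] by simp
        moreover have "dX p p' \<le> dX x p + dX x p'"
          using X.triangle[of p x p'] R_sub[OF pq] R_sub[OF pq'] that X.commute[of p x] by simp
        ultimately show "dY y y' - (dX x p + dY q y + c) \<le> dX x p' + dY q' y' + c"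
          using dis[OF pq pq'] by linarith
      qed
      then show "dY y y' - D x y' \<le> dX x p + dY q y + c" by simp
    qed
    then show ?thesis by simp
  qed
  have M: "Metric_space Z dZ"
  proof
    show "0 \<le> dZ u v" for u v
      using D_pos by (auto simp: dZ_def less_imp_le split: sum.split)
    show "dZ u v = dZ v u" for u v
      by (auto simp: dZ_def X.commute Y.commute split: sum.split)
    show "dZ u v = 0 \<longleftrightarrow> u = v" if "u \<in> Z" "v \<in> Z" for u v
      using that D_pos by (auto simp: dZ_def Z_def less_le split: sum.split)
    show "dZ u w \<le> dZ u v + dZ v w" if "u \<in> Z" "v \<in> Z" "w \<in> Z" for u v w
      using that unfolding Z_def
      by (elim PlusE)
        (auto simp: dZ_def intro: XXY XXY' XYY XYY' XYX YXY X.triangle Y.triangle)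
  qed
  have D_R: "D x y \<le> c" if "(x, y) \<in> R" for x y
    using D_le[OF that, of x y] R_sub[OF that] by simp
  have bb: "bdd_below (range (D x))" "bdd_below (range (\<lambda>x. D x y))" for x y
    using D_pos by (auto intro!: bdd_belowI[of _ 0] simp: less_imp_le)
  have "(SUP x\<in>X. INF y\<in>Y. D x y) \<le> c"
  proof (rule cSUP_least)
    fix x assume "x \<in> X"
    then obtain y where "(x, y) \<in> R"
      using R by (force simp: correspondence_def)
    then show "(INF y\<in>Y. D x y) \<le> c"
      using R_sub D_R by (intro cINF_lower2[of _ _ y] bdd_below_mono[OF bb(1)]) auto
  qed (rule ne)
  moreover have "(SUP y\<in>Y. INF x\<in>X. D x y) \<le> c"
  proof (rule cSUP_least)
    fix y assume "y \<in> Y"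
    then obtain x where "(x, y) \<in> R"
      using R by (force simp: correspondence_def)
    then show "(INF x\<in>X. D x y) \<le> c"
      using R_sub D_R by (intro cINF_lower2[of _ _ x] bdd_below_mono[OF bb(2)]) auto
  qed (rule ne)
  ultimately have "hausdorff_dist dZ (Inl ` X) (Inr ` Y) \<le> c"
    by (simp add: hausdorff_dist_def image_image dZ_def)
  then show thesis
    by (intro that[OF M]) (auto simp: isometric_embedding_def Z_def dZ_def)
qed

lemma gh_dist_le_half_distortion:
  fixes X :: "'a set" and Y :: "'b set"
  assumes "Metric_space X dX" "Metric_space Y dY"
    and "correspondence X Y R" and ne: "X \<noteq> {}" "Y \<noteq> {}" and "0 < c"
    and "\<And>x y x' y'. (x, y) \<in> R \<Longrightarrow> (x', y') \<in> R \<Longrightarrow> \<bar>dX x x' - dY y y'\<bar> \<le> 2 * c"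
    and bdd: "\<And>x x'. x \<in> X \<Longrightarrow> x' \<in> X \<Longrightarrow> dX x x' \<le> C"
  shows "gh_dist X dX Y dY \<le> c"
proof -
  obtain Z :: "('a + 'b) set" and dZ where Z: "Metric_space Z dZ"
    "isometric_embedding X dX Z dZ Inl" "isometric_embedding Y dY Z dZ Inr"
    "hausdorff_dist dZ (Inl ` X) (Inr ` Y) \<le> c"
    using correspondence_imp_glued_metric[OF assms(1-7)] by blast
  show ?thesis
    using gh_dist_le[OF Z(1-3) ne bdd] Z(4) by linarith
qed

text \<open>
  The pairs of points whose images are at distance less than \<open>r\<close> form the correspondence.  The
  boundedness of both spaces is what gives meaning to the two real suprema in the Hausdorff
  distance.
\<close>

lemma hausdorff_less_imp_correspondence:
  assumes M: "Metric_space Z d"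
    and f: "isometric_embedding X dX Z d f" and g: "isometric_embedding Y dY Z d g"
    and ne: "X \<noteq> {}" "Y \<noteq> {}"
    and bddX: "\<And>x x'. x \<in> X \<Longrightarrow> x' \<in> X \<Longrightarrow> dX x x' \<le> C"
    and bddY: "\<And>y y'. y \<in> Y \<Longrightarrow> y' \<in> Y \<Longrightarrow> dY y y' \<le> C'"
    and less: "hausdorff_dist d (f ` X) (g ` Y) < r"
  obtains R where "correspondence X Y R"
    "\<And>x y x' y'. (x, y) \<in> R \<Longrightarrow> (x', y') \<in> R \<Longrightarrow> \<bar>dX x x' - dY y y'\<bar> \<le> 2 * r"
proof -
  interpret Metric_space Z d by fact
  have fZ: "f x \<in> Z" if "x \<in> X" for x using f that by (auto simp: isometric_embedding_def)
  have gZ: "g y \<in> Z" if "y \<in> Y" for y using g that by (auto simp: isometric_embedding_def)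
  obtain x0 y0 where x0: "x0 \<in> X" and y0: "y0 \<in> Y" using ne by blast
  have bb: "bdd_below ((\<lambda>y. d (f x) (g y)) ` Y)" "bdd_below ((\<lambda>x. d (f x) (g y)) ` X)" for x y
    by (auto intro!: bdd_belowI[of _ 0])
  have near_y: "\<exists>y\<in>Y. d (f x) (g y) < r" if x: "x \<in> X" for x
  proof -
    have "bdd_above ((\<lambda>x. INF y\<in>Y. d (f x) (g y)) ` X)"
    proof (rule bdd_aboveI2)
      fix x assume x: "x \<in> X"
      have "d (f x) (g y0) \<le> d (f x) (f x0) + d (f x0) (g y0)"
        using x x0 y0 by (intro triangle fZ gZ)
      also have "\<dots> \<le> C + d (f x0) (g y0)"
        using bddX[OF x x0] f x x0 by (simp add: isometric_embedding_def)
      finally show "(INF y\<in>Y. d (f x) (g y)) \<le> C + d (f x0) (g y0)"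
        using y0 by (intro cINF_lower2[OF bb(1)]) auto
    qed
    from cSUP_upper[OF x this] less have "(INF y\<in>Y. d (f x) (g y)) < r"
      by (simp add: hausdorff_dist_def image_image)
    then show ?thesis
      by (simp add: cINF_less_iff[OF ne(2) bb(1)])
  qed
  have near_x: "\<exists>x\<in>X. d (f x) (g y) < r" if y: "y \<in> Y" for y
  proof -
    have "bdd_above ((\<lambda>y. INF x\<in>X. d (f x) (g y)) ` Y)"
    proof (rule bdd_aboveI2)
      fix y assume y: "y \<in> Y"
      have "d (f x0) (g y) \<le> d (f x0) (g y0) + d (g y0) (g y)"
        using y x0 y0 by (intro triangle fZ gZ)
      also have "\<dots> \<le> d (f x0) (g y0) + C'"
        using bddY[OF y0 y] g y y0 by (simp add: isometric_embedding_def)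
      finally show "(INF x\<in>X. d (f x) (g y)) \<le> d (f x0) (g y0) + C'"
        using x0 by (intro cINF_lower2[OF bb(2)]) auto
    qed
    from cSUP_upper[OF y this] less have "(INF x\<in>X. d (f x) (g y)) < r"
      by (simp add: hausdorff_dist_def image_image)
    then show ?thesis
      by (simp add: cINF_less_iff[OF ne(1) bb(2)])
  qed
  define R where "R = {(x, y) \<in> X \<times> Y. d (f x) (g y) < r}"
  show thesis
  proof (rule that)
    show "correspondence X Y R"
      using near_x near_y by (force simp: correspondence_def R_def)
    fix x y x' y' assume "(x, y) \<in> R" "(x', y') \<in> R"
    then have *: "x \<in> X" "y \<in> Y" "x' \<in> X" "y' \<in> Y" "d (f x) (g y) < r" "d (f x') (g y') < r"
      by (auto simp: R_def)
    have "dX x x' = d (f x) (f x')" "dY y y' = d (g y) (g y')"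
      using f g * by (auto simp: isometric_embedding_def)
    moreover have "d (f x) (f x') \<le> d (f x) (g y) + d (g y) (g y') + d (f x') (g y')"
      using triangle[OF fZ gZ fZ, OF *(1,2,3)] triangle[OF gZ gZ fZ, OF *(2,4,3)]
        commute[of "g y'" "f x'"] by linarith
    moreover have "d (g y) (g y') \<le> d (f x) (g y) + d (f x) (f x') + d (f x') (g y')"
      using triangle[OF gZ fZ gZ, OF *(2,1,4)] triangle[OF fZ fZ gZ, OF *(1,3,4)]
        commute[of "g y" "f x"] by linarith
    ultimately show "\<bar>dX x x' - dY y y'\<bar> \<le> 2 * r"
      using * by linarith
  qed
qed

section \<open>Chord metrics on spaces of diameter at most \<open>\<pi>\<close>\<close>

text \<open>
  For every \<open>r\<close> above the Gromov-Hausdorff distance of the original metrics the chord metrics are at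
  distance at most \<open>sin (min (pi / 2) r)\<close>; then let \<open>r\<close> decrease.  The minimum is there because the sine
  increases only up to \<open>pi / 2\<close>, and it disappears in the limit because the full correspondence
  bounds the original distance by \<open>pi / 2\<close>.
\<close>

theorem gh_dist_chord_le_sin:
  fixes X :: "'a set" and Y :: "'b set"
  assumes MX: "Metric_space X dX" and MY: "Metric_space Y dY" and ne: "X \<noteq> {}" "Y \<noteq> {}"
    and le_pi: "\<And>x x'. dX x x' \<le> pi" "\<And>y y'. dY y y' \<le> pi"
  shows "gh_dist X (\<lambda>x x'. chord (dX x x')) Y (\<lambda>y y'. chord (dY y y'))
           \<le> sin (gh_dist X dX Y dY)"
    (is "?E \<le> sin ?G")
proof -
  interpret X: Metric_space X dX by fact
  interpret Y: Metric_space Y dY by fact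
  let ?S = "{hausdorff_dist dZ (f ` X) (g ` Y) | (Z :: ('a + 'b) set) dZ f g.
            Metric_space Z dZ \<and> isometric_embedding X dX Z dZ f \<and> isometric_embedding Y dY Z dZ g}"
  have full: "correspondence X Y (X \<times> Y)"
    using ne by (auto simp: correspondence_def)
  have full_dis: "\<bar>dX x x' - dY y y'\<bar> \<le> 2 * (pi / 2)" for x x' y y'
    using le_pi(1)[of x x'] le_pi(2)[of y y'] X.nonneg[of x x'] Y.nonneg[of y y'] by linarith
  have G_le: "?G \<le> pi / 2"
    by (rule gh_dist_le_half_distortion[OF MX MY full ne _ full_dis le_pi(1)]) simp
  have S_ne: "?S \<noteq> {}"
  proof -
    obtain Z :: "('a + 'b) set" and dZ where "Metric_space Z dZ"
      "isometric_embedding X dX Z dZ Inl" "isometric_embedding Y dY Z dZ Inr"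
      using correspondence_imp_glued_metric[OF MX MY full ne pi_half_gt_zero full_dis] by metis
    then show ?thesis by blast
  qed
  have E_le: "?E \<le> sin (min (pi / 2) r)" if "?G < r" for r
  proof -
    obtain Z :: "('a + 'b) set" and dZ f g where Z: "Metric_space Z dZ"
        "isometric_embedding X dX Z dZ f" "isometric_embedding Y dY Z dZ g"
      and less: "hausdorff_dist dZ (f ` X) (g ` Y) < r"
      using cInf_lessD[OF S_ne] \<open>?G < r\<close> unfolding gh_dist_def by blast
    obtain R where R: "correspondence X Y R"
      and dis: "\<And>x y x' y'. (x, y) \<in> R \<Longrightarrow> (x', y') \<in> R \<Longrightarrow> \<bar>dX x x' - dY y y'\<bar> \<le> 2 * r"
      using hausdorff_less_imp_correspondence[OF Z ne le_pi less] by blast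
    have "0 \<le> hausdorff_dist dZ (f ` X) (g ` Y)"
      by (rule hausdorff_dist_nonneg[OF Z(1), where C = pi])
        (use Z ne le_pi in \<open>auto simp: isometric_embedding_def\<close>)
    with less have "0 < r" by simp
    show ?thesis
    proof (rule gh_dist_le_half_distortion[OF _ _ R ne])
      show "Metric_space X (\<lambda>x x'. chord (dX x x'))" "Metric_space Y (\<lambda>y y'. chord (dY y y'))"
        using MX MY le_pi by (auto intro: Metric_space_chord)
      show "0 < sin (min (pi / 2) r)"
        using \<open>0 < r\<close> by (intro sin_gt_zero) (auto simp: min_def intro: less_le_trans)
      show "chord (dX x x') \<le> chord pi" for x x'
        by (intro chord_mono le_pi) auto
      fix x y x' y' assume "(x, y) \<in> R" "(x', y') \<in> R"
      then have "\<bar>dX x x' - dY y y'\<bar> \<le> 2 * min (pi / 2) r"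
        using dis full_dis by (auto simp: min_def)
      then have "chord \<bar>dX x x' - dY y y'\<bar> \<le> chord (2 * min (pi / 2) r)"
        by (intro chord_mono) auto
      moreover have "\<bar>chord (dX x x') - chord (dY y y')\<bar> \<le> chord \<bar>dX x x' - dY y y'\<bar>"
        by (intro chord_diff_le le_pi) auto
      ultimately show "\<bar>chord (dX x x') - chord (dY y y')\<bar> \<le> 2 * sin (min (pi / 2) r)"
        by (simp add: chord_def)
    qed
  qed
  have "((\<lambda>r. sin (min (pi / 2) r)) \<longlongrightarrow> sin (min (pi / 2) ?G)) (at_right ?G)"
    by (intro tendsto_intros)
  moreover have "eventually (\<lambda>r. ?E \<le> sin (min (pi / 2) r)) (at_right ?G)"
    using E_le by (auto simp: eventually_at_filter)
  ultimately have "?E \<le> sin (min (pi / 2) ?G)"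
    by (intro tendsto_lowerbound) auto
  then show ?thesis
    using G_le by (simp add: min_absorb2)
qed

section \<open>The geodesic metric on the unit sphere\<close>

lemma l2_summable_mult:
  assumes "x \<in> l2_space" "y \<in> l2_space"
  shows "summable (\<lambda>i. x i * y i)"
proof (rule summable_comparison_test)
  show "summable (\<lambda>i. (x i)\<^sup>2 + (y i)\<^sup>2)"
    using assms by (simp add: l2_space_def summable_add)
  have "\<bar>a * b\<bar> \<le> a\<^sup>2 + b\<^sup>2" for a b :: real
    using sum_squares_bound[of "\<bar>a\<bar>" "\<bar>b\<bar>"] abs_ge_zero[of "a * b"]
    unfolding abs_mult power2_abs by linarith
  then show "\<exists>N. \<forall>i\<ge>N. norm (x i * y i) \<le> (x i)\<^sup>2 + (y i)\<^sup>2"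
    by auto
qed

lemma unit_sphere_in_l2: "x \<in> unit_sphere n \<Longrightarrow> x \<in> l2_space"
  by (simp add: unit_sphere_def)

lemma unit_sphere_inner_self: "x \<in> unit_sphere n \<Longrightarrow> l2_inner x x = 1"
  by (simp add: unit_sphere_def l2_norm_def)

lemma unit_sphere_combination_sums:
  assumes "x \<in> unit_sphere n" "y \<in> unit_sphere n" "z \<in> unit_sphere n"
  shows "(\<lambda>i. (a * x i + b * y i + c * z i)\<^sup>2) sums
    (a\<^sup>2 + b\<^sup>2 + c\<^sup>2 + 2 * (a * b * l2_inner x y + b * c * l2_inner y z + a * c * l2_inner x z))"
proof -
  have s: "(\<lambda>i. u i * v i) sums l2_inner u v" if "u \<in> unit_sphere n" "v \<in> unit_sphere n" for u v
    unfolding l2_inner_def using that by (intro summable_sums l2_summable_mult unit_sphere_in_l2)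
  have "(\<lambda>i. a\<^sup>2 * (x i * x i) + b\<^sup>2 * (y i * y i) + c\<^sup>2 * (z i * z i)
      + 2 * (a * b * (x i * y i) + b * c * (y i * z i) + a * c * (x i * z i))) sums
    (a\<^sup>2 * l2_inner x x + b\<^sup>2 * l2_inner y y + c\<^sup>2 * l2_inner z z
      + 2 * (a * b * l2_inner x y + b * c * l2_inner y z + a * c * l2_inner x z))"
    by (intro sums_add sums_mult s assms)
  then show ?thesis
    using assms by (simp add: unit_sphere_inner_self power2_eq_square algebra_simps)
qed

lemma gram_form_nonneg:
  assumes "x \<in> unit_sphere n" "y \<in> unit_sphere n" "z \<in> unit_sphere n"
  shows "0 \<le> a\<^sup>2 + b\<^sup>2 + c\<^sup>2
    + 2 * (a * b * l2_inner x y + b * c * l2_inner y z + a * c * l2_inner x z)"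
  using sums_le[OF _ sums_zero unit_sphere_combination_sums[OF assms]] by simp

lemma unit_sphere_inner_bounds:
  assumes "x \<in> unit_sphere n" "y \<in> unit_sphere n"
  shows "-1 \<le> l2_inner x y" "l2_inner x y \<le> 1"
  using gram_form_nonneg[OF assms assms(2), of 1 1 0] gram_form_nonneg[OF assms assms(2), of 1 "-1" 0]
  by auto

lemma discriminant_nonpos_if_form_nonneg:
  fixes A B C :: real
  assumes form: "\<And>a c. 0 \<le> a\<^sup>2 * A + c\<^sup>2 * B + 2 * a * c * C"
  shows "C\<^sup>2 \<le> A * B"
proof -
  have AB: "0 \<le> A" "0 \<le> B"
    using form[of 1 0] form[of 0 1] by auto
  show ?thesis
  proof (cases "A = 0")
    case True
    have "0 \<le> - (C\<^sup>2 * (B + 2))"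
      using form[of "B + 1" "- C"] True by (simp add: power2_eq_square algebra_simps)
    then show ?thesis
      using AB True by (simp add: mult_le_0_iff)
  next
    case False
    have "0 \<le> A * (A * B - C\<^sup>2)"
      using form[of "- C" A] by (simp add: power2_eq_square algebra_simps)
    then show ?thesis
      using AB False by (simp add: zero_le_mult_iff)
  qed
qed

text \<open>
  Cauchy-Schwarz for the components of \<open>x\<close> and \<open>z\<close> orthogonal to \<open>y\<close>: their inner product is
  \<open>\<langle>x, z\<rangle> - \<langle>x, y\<rangle> \<langle>y, z\<rangle>\<close>.
\<close>

lemma unit_sphere_gram_inequality:
  assumes "x \<in> unit_sphere n" "y \<in> unit_sphere n" "z \<in> unit_sphere n"
  shows "(l2_inner x z - l2_inner x y * l2_inner y z)\<^sup>2
    \<le> (1 - (l2_inner x y)\<^sup>2) * (1 - (l2_inner y z)\<^sup>2)"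
proof (rule discriminant_nonpos_if_form_nonneg)
  fix a c
  \<comment> \<open>This coefficient of \<open>y\<close> makes the combination orthogonal to \<open>y\<close>.\<close>
  show "0 \<le> a\<^sup>2 * (1 - (l2_inner x y)\<^sup>2) + c\<^sup>2 * (1 - (l2_inner y z)\<^sup>2)
      + 2 * a * c * (l2_inner x z - l2_inner x y * l2_inner y z)"
    using gram_form_nonneg[OF assms, of a "- (a * l2_inner x y + c * l2_inner y z)" c]
    by (simp add: power2_eq_square algebra_simps)
qed

text \<open>
  The preceding inequality bounds \<open>\<langle>x, z\<rangle>\<close> below by \<open>cos \<alpha> cos \<beta> - sin \<alpha> sin \<beta> = cos (\<alpha> + \<beta>)\<close>, where
  \<open>\<alpha>\<close> and \<open>\<beta>\<close> are the two sides meeting in \<open>y\<close>.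
\<close>

lemma geodesic_dist_triangle:
  assumes "x \<in> unit_sphere n" "y \<in> unit_sphere n" "z \<in> unit_sphere n"
  shows "geodesic_dist x z \<le> geodesic_dist x y + geodesic_dist y z"
proof -
  define \<alpha> \<beta> where "\<alpha> = geodesic_dist x y" and "\<beta> = geodesic_dist y z"
  let ?p = "l2_inner x y" and ?q = "l2_inner y z" and ?s = "l2_inner x z"
  note bounds = unit_sphere_inner_bounds[OF assms(1,2)] unit_sphere_inner_bounds[OF assms(2,3)]
    unit_sphere_inner_bounds[OF assms(1,3)]
  have ranges: "0 \<le> \<alpha>" "0 \<le> \<beta>"
    using bounds by (auto simp: \<alpha>_def \<beta>_def geodesic_dist_def arccos_lbound)
  have "\<bar>?s - ?p * ?q\<bar> \<le> sqrt ((1 - ?p\<^sup>2) * (1 - ?q\<^sup>2))"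
    using unit_sphere_gram_inequality[OF assms] by (metis real_sqrt_abs real_sqrt_le_mono)
  also have "\<dots> = sin \<alpha> * sin \<beta>"
    using bounds by (simp add: \<alpha>_def \<beta>_def geodesic_dist_def sin_arccos real_sqrt_mult)
  finally have "cos \<alpha> * cos \<beta> - sin \<alpha> * sin \<beta> \<le> ?s"
    using bounds by (simp add: \<alpha>_def \<beta>_def geodesic_dist_def)
  then have cos_le: "cos (\<alpha> + \<beta>) \<le> ?s"
    by (simp add: cos_add)
  have "arccos ?s \<le> \<alpha> + \<beta>"
  proof (cases "\<alpha> + \<beta> \<le> pi")
    case True
    then have "arccos ?s \<le> arccos (cos (\<alpha> + \<beta>))"
      using cos_le bounds by (intro arccos_le_arccos) auto
    with True ranges show ?thesis
      by (simp add: arccos_cos)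
  next
    case False
    with arccos_ubound[OF bounds(5,6)] show ?thesis by linarith
  qed
  then show ?thesis
    by (simp add: \<alpha>_def \<beta>_def geodesic_dist_def)
qed

lemma geodesic_dist_bounds:
  assumes "x \<in> unit_sphere n" "y \<in> unit_sphere n"
  shows "0 \<le> geodesic_dist x y" "geodesic_dist x y \<le> pi"
  using unit_sphere_inner_bounds[OF assms] by (auto simp: geodesic_dist_def arccos_lbound arccos_ubound)

text \<open>Both sides have the square \<open>2 - 2 \<langle>x, y\<rangle>\<close>.\<close>

lemma euclidean_dist_eq_chord:
  assumes "x \<in> unit_sphere n" "y \<in> unit_sphere n"
  shows "euclidean_dist x y = chord (geodesic_dist x y)"
proof -
  have "(\<lambda>i. (x i - y i)\<^sup>2) sums (2 - 2 * l2_inner x y)"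
    using unit_sphere_combination_sums[OF assms assms(2), of 1 "-1" 0] by simp
  then have "euclidean_dist x y = sqrt (2 - 2 * l2_inner x y)"
    by (simp add: euclidean_dist_def l2_norm_def l2_inner_def sums_iff flip: power2_eq_square)
  also have "2 - 2 * l2_inner x y = (chord (geodesic_dist x y))\<^sup>2"
    using cos_double_sin[of "geodesic_dist x y / 2"] unit_sphere_inner_bounds[OF assms]
    by (simp add: chord_def geodesic_dist_def power2_eq_square)
  finally show ?thesis
    using chord_nonneg geodesic_dist_bounds[OF assms] by simp
qed

lemma geodesic_dist_eq_0_iff:
  assumes "x \<in> unit_sphere n" "y \<in> unit_sphere n"
  shows "geodesic_dist x y = 0 \<longleftrightarrow> x = y"
proof
  assume "geodesic_dist x y = 0"
  then have "l2_inner x y = 1"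
    using cos_arccos[OF unit_sphere_inner_bounds[OF assms]] by (simp add: geodesic_dist_def)
  then have "(\<lambda>i. (x i - y i)\<^sup>2) sums 0"
    using unit_sphere_combination_sums[OF assms assms(2), of 1 "-1" 0] by simp
  then have "\<forall>i. (x i - y i)\<^sup>2 = 0"
    by (subst suminf_eq_zero_iff[symmetric]) (auto simp: sums_iff)
  then show "x = y" by auto
next
  assume "x = y"
  then show "geodesic_dist x y = 0"
    using assms by (simp add: geodesic_dist_def unit_sphere_inner_self)
qed

text \<open>
  The geodesic distance cut off to \<open>0\<close> outside \<open>X\<close>: metric spaces are required to have a nonnegative
  distance on the whole type, whereas an \<open>arccos\<close> outside \<open>[-1, 1]\<close> has no specified value.
\<close>

definition geodesic_dist_on :: "(nat \<Rightarrow> real) set \<Rightarrow> (nat \<Rightarrow> real) \<Rightarrow> (nat \<Rightarrow> real) \<Rightarrow> real" where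
  "geodesic_dist_on X x y = (if x \<in> X \<and> y \<in> X then geodesic_dist x y else 0)"

lemma Metric_space_geodesic_dist_on:
  assumes "X \<subseteq> unit_sphere n"
  shows "Metric_space X (geodesic_dist_on X)"
proof
  show "0 \<le> geodesic_dist_on X x y" for x y
    using assms by (auto simp: geodesic_dist_on_def intro: geodesic_dist_bounds)
  show "geodesic_dist_on X x y = geodesic_dist_on X y x" for x y
    by (simp add: geodesic_dist_on_def geodesic_dist_def l2_inner_def mult.commute)
  show "geodesic_dist_on X x y = 0 \<longleftrightarrow> x = y" if "x \<in> X" "y \<in> X" for x y
    using that geodesic_dist_eq_0_iff[of x n y] assms by (auto simp: geodesic_dist_on_def)
  show "geodesic_dist_on X x z \<le> geodesic_dist_on X x y + geodesic_dist_on X y z"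
    if "x \<in> X" "y \<in> X" "z \<in> X" for x y z
    using assms that by (auto simp: geodesic_dist_on_def intro!: geodesic_dist_triangle[of _ n])
qed

lemma geodesic_dist_on_le_pi: "X \<subseteq> unit_sphere n \<Longrightarrow> geodesic_dist_on X x y \<le> pi"
  by (auto simp: geodesic_dist_on_def intro: geodesic_dist_bounds)

theorem gh_dist_euclidean_le_sin_gh_dist_geodesic:
  assumes X: "X \<subseteq> unit_sphere k" "X \<noteq> {}" and Y: "Y \<subseteq> unit_sphere n" "Y \<noteq> {}"
  shows "gh_dist X euclidean_dist Y euclidean_dist \<le> sin (gh_dist X geodesic_dist Y geodesic_dist)"
proof -
  have "gh_dist X euclidean_dist Y euclidean_dist =
      gh_dist X (\<lambda>x x'. chord (geodesic_dist_on X x x')) Y (\<lambda>y y'. chord (geodesic_dist_on Y y y'))"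
    using X Y
    by (intro gh_dist_cong)
      (auto simp: geodesic_dist_on_def subset_iff
        euclidean_dist_eq_chord[where n = k] euclidean_dist_eq_chord[where n = n])
  also have "\<dots> \<le> sin (gh_dist X (geodesic_dist_on X) Y (geodesic_dist_on Y))"
    using X Y by (intro gh_dist_chord_le_sin Metric_space_geodesic_dist_on geodesic_dist_on_le_pi)
  also have "gh_dist X (geodesic_dist_on X) Y (geodesic_dist_on Y)
      = gh_dist X geodesic_dist Y geodesic_dist"
    by (intro gh_dist_cong) (auto simp: geodesic_dist_on_def)
  finally show ?thesis .
qed

lemma unit_sphere_nonempty: "unit_sphere n \<noteq> {}"
proof -
  define e :: "nat \<Rightarrow> real" where "e i = (if i = 0 then 1 else 0)" for i
  have "(\<lambda>i. (e i)\<^sup>2) sums 1"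
    using sums_single[of 0 "\<lambda>_. 1 :: real"]
    by (simp add: e_def if_distrib[where f = "\<lambda>t. t\<^sup>2"] cong: if_cong)
  then have "e \<in> unit_sphere n"
    by (auto simp: unit_sphere_def l2_space_def l2_norm_def l2_inner_def sums_iff e_def
        zero_enat_def[symmetric] simp flip: power2_eq_square)
  then show ?thesis by blast
qed

theorem corollary9p8:
  fixes m :: nat and n :: enat
  assumes "enat m < n"
  shows "gh_dist (unit_sphere (enat m)) euclidean_dist (unit_sphere n) euclidean_dist
           \<le> sin (gh_dist (unit_sphere (enat m)) geodesic_dist (unit_sphere n) geodesic_dist)
       \<and> (\<forall>X Y. X \<subseteq> unit_sphere (enat m) \<and> X \<noteq> {} \<and> Y \<subseteq> unit_sphere n \<and> Y \<noteq> {} \<longrightarrow>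
           gh_dist X euclidean_dist Y euclidean_dist
             \<le> sin (gh_dist X geodesic_dist Y geodesic_dist))"
  by (intro conjI allI impI gh_dist_euclidean_le_sin_gh_dist_geodesic unit_sphere_nonempty) auto

end
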